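(* Let $(M,d)$ be a compact Polish space. Let $T:M\to M$ and $\tilde T:M\to M$ be two continuous functions and let $\nu$ be a probability measure on $M$ equipped with the Borel $\sigma$-algebra. Then for every $q\in[1,\infty)$ $$W_q(T_\sharp\nu,\tilde T_\sharp\nu)\le\sup_{x\in M}d(T(x),\tilde T(x))<\infty.$$
   Context: A Polish space $(M,d)$ is a separable and complete metric space with metric $d$. For $q\in[1,\infty)$ and Borel probability measures $\nu,\eta$ on $M$, $W_q(\nu,\eta)=\inf_{\gamma\in\Gamma}\left(\int_{M\times M}d(x,y)^q\,d\gamma(x,y)\right)^{1/q}$, where $\Gamma$ is the set of probability measures on $M\times M$ with marginals $\nu$ and $\eta$. $T_\sharp\nu$ is the pushforward, $T_\sharp\nu(A)=\nu(T^{-1}(A))$. *)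

theory Defs
  imports "HOL-Probability.Probability"
begin

text \<open>
  Real powers on the extended non-negative reals, for positive exponents:
  infinity is mapped to infinity, finite values follow \<^const>\<open>powr\<close>.
\<close>
definition ennreal_powr :: "ennreal \<Rightarrow> real \<Rightarrow> ennreal" where
  "ennreal_powr x p = (if x = \<infinity> then \<infinity> else ennreal (enn2real x powr p))"

definition couplings ::
  "'a::polish_space measure \<Rightarrow> 'a measure \<Rightarrow> ('a \<times> 'a) measure set" where
  "couplings \<nu> \<eta> =
    {\<gamma>. prob_space \<gamma> \<and> sets \<gamma> = sets borel \<and> distr \<gamma> borel fst = \<nu> \<and> distr \<gamma> borel snd = \<eta>}"

text \<open>
  The value lies in \<^typ>\<open>ennreal\<close>: without moment conditions on the marginals it may be infinite.
\<close>
definition wasserstein ::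
  "real \<Rightarrow> 'a::polish_space measure \<Rightarrow> 'a measure \<Rightarrow> ennreal" where
  "wasserstein q \<nu> \<eta> =
    (INF \<gamma>\<in>couplings \<nu> \<eta>.
      ennreal_powr (\<integral>\<^sup>+ (x, y). ennreal (dist x y powr q) \<partial>\<gamma>) (1 / q))"

end

theory Submission
  imports Defs
begin

text \<open>Push \<nu> forward along x \<mapsto> (T x, T' x). This is a coupling of the two image
  measures, generally not optimal, and its cost is the \<nu>-integral of d(T x, T' x)^q. If b bounds
  d(T x, T' x) everywhere, this integral is at most b^q because \<nu> has mass one, and the q-th
  root gives b (\<open>wasserstein_distr_le\<close>). Compactness makes the continuous function d(T
  x, T' x) attain its maximum, so the supremum is a real number and can serve as b.\<close>

lemma ennreal_powr_le_ennreal: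
  assumes "x \<le> ennreal (b powr q)" "0 \<le> b" "0 < q"
  shows "ennreal_powr x (1 / q) \<le> ennreal b"
proof -
  \<comment> \<open>Finiteness selects the real branch of \<open>ennreal_powr\<close>;
    \<open>enn2real\<close> alone would not detect x = \<infinity>, which it sends to 0.\<close>
  have fin: "x < \<infinity>"
    using assms(1) ennreal_less_top le_less_trans by (metis infinity_ennreal_def)
  have "enn2real x \<le> b powr q"
    using assms(1) by (intro enn2real_leI) auto
  then have "enn2real x powr (1 / q) \<le> (b powr q) powr (1 / q)"
    using assms(3) by (intro powr_mono2) auto
  also have "\<dots> = b"
    using assms(2,3) by (simp add: powr_powr)
  finally show ?thesis
    using fin by (auto simp: ennreal_powr_def intro: ennreal_leI)
qed

text \<open>Two random variables on one probability space are coupled by their joint law: composing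
  the pair map with a projection gives back f or g.\<close>

lemma distr_Pair_in_couplings:
  fixes f g :: "'b \<Rightarrow> 'a::polish_space"
  assumes "prob_space M" "f \<in> borel_measurable M" "g \<in> borel_measurable M"
  shows "distr M borel (\<lambda>x. (f x, g x)) \<in> couplings (distr M borel f) (distr M borel g)"
proof -
  have pair: "(\<lambda>x. (f x, g x)) \<in> borel_measurable M"
    using assms(2,3) by (rule borel_measurable_Pair)
  have "fst \<in> borel_measurable (borel :: ('a \<times> 'a) measure)"
    "snd \<in> borel_measurable (borel :: ('a \<times> 'a) measure)"
    by (intro borel_measurable_continuous_onI continuous_intros)+
  then show ?thesis
    using pair prob_space.prob_space_distr[OF assms(1) pair]
    by (simp add: couplings_def distr_distr comp_def)
qed

text \<open>The infimum over couplings is at most the cost of the joint law of f and g. A real bound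
  b keeps the estimate free of suprema and compactness.\<close>

lemma wasserstein_distr_le:
  fixes f g :: "'b \<Rightarrow> 'a::polish_space"
  assumes "prob_space M" "f \<in> borel_measurable M" "g \<in> borel_measurable M"
    and "0 < q" "0 \<le> b" "\<And>x. x \<in> space M \<Longrightarrow> dist (f x) (g x) \<le> b"
  shows "wasserstein q (distr M borel f) (distr M borel g) \<le> ennreal b"
proof -
  interpret prob_space M by fact
  define \<gamma> where "\<gamma> = distr M borel (\<lambda>x. (f x, g x))"
  have "(\<lambda>p. dist (fst p) (snd p)) \<in> borel_measurable (borel :: ('a \<times> 'a) measure)"
    by (intro borel_measurable_continuous_onI continuous_intros)
  then have cost: "(\<lambda>p. ennreal (dist (fst p) (snd p) powr q))
      \<in> borel_measurable (borel :: ('a \<times> 'a) measure)"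
    by measurable
  have "(\<integral>\<^sup>+ (x, y). ennreal (dist x y powr q) \<partial>\<gamma>)
      = (\<integral>\<^sup>+ x. ennreal (dist (f x) (g x) powr q) \<partial>M)"
    unfolding \<gamma>_def
    using assms(2,3) cost
    by (subst nn_integral_distr) (auto simp: case_prod_beta' intro!: borel_measurable_Pair)
  also have "\<dots> \<le> (\<integral>\<^sup>+ x. ennreal (b powr q) \<partial>M)"
    using assms(4,6) by (intro nn_integral_mono ennreal_leI powr_mono2) auto
  \<comment> \<open>Total mass one enters here: the constant integrates to itself.\<close>
  also have "\<dots> = ennreal (b powr q)"
    by (simp add: emeasure_space_1)
  finally have "ennreal_powr (\<integral>\<^sup>+ (x, y). ennreal (dist x y powr q) \<partial>\<gamma>) (1 / q) \<le> ennreal b"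
    using assms(4,5) by (intro ennreal_powr_le_ennreal)
  then show ?thesis
    unfolding wasserstein_def \<gamma>_def
    by (rule INF_lower2[OF distr_Pair_in_couplings[OF assms(1-3)]])
qed

theorem proposition6p2:
  fixes T T' :: "'a::polish_space \<Rightarrow> 'a"
    and \<nu> :: "'a measure"
    and q :: real
  assumes "compact (UNIV :: 'a set)"
    and "continuous_on UNIV T"
    and "continuous_on UNIV T'"
    and "prob_space \<nu>"
    and "sets \<nu> = sets borel"
    and "q \<ge> 1"
  shows "wasserstein q (distr \<nu> borel T) (distr \<nu> borel T')
           \<le> (SUP x. ennreal (dist (T x) (T' x))) \<and>
         (SUP x. ennreal (dist (T x) (T' x))) < \<infinity>"
proof -
  \<comment> \<open>The maximum at z yields both conclusions: the supremum is the finite value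
    there, and that value is the uniform bound b.\<close>
  obtain z where z: "dist (T x) (T' x) \<le> dist (T z) (T' z)" for x
    using continuous_attains_sup[OF assms(1) UNIV_not_empty continuous_on_dist[OF assms(2,3)]]
    by auto
  have sup: "(SUP x. ennreal (dist (T x) (T' x))) = ennreal (dist (T z) (T' z))"
    using z by (intro antisym SUP_least SUP_upper ennreal_leI) auto
  have "T \<in> borel_measurable \<nu>" "T' \<in> borel_measurable \<nu>"
    using assms(2,3) borel_measurable_continuous_onI measurable_cong_sets[OF assms(5) refl]
    by blast+
  then show ?thesis
    unfolding sup using assms(4,6) z by (auto intro!: wasserstein_distr_le)
qed

end
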